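(* Let $m<n$, $\mathbf{y}\in\mathbb{R}^m$, $\lambda>0$. Let $\mathbf{A}\in\mathbb{R}^{n\times n}$ be the matrix of a periodic two-dimensional convolution, let $\mathbf{M}\in\{0,1\}^{m\times n}$ be a masking matrix (its rows are a subset of the rows of the $n\times n$ identity matrix), and for $i=1,\dots,n$ let $\mathbf{D}_i\in\mathbb{R}^{2\times n}$ be the matrix computing the horizontal and vertical differences at pixel $i$ with periodic boundary conditions. If $\mathbf{1}\notin\ker(\mathbf{M}\mathbf{A})$, where $\mathbf{1}$ is the vector with all entries equal to one, then, for any $\mu_1,\mu_2>0$ and any initialization, the sequence $(\mathbf{z}_k)$ generated by Algorithm TV-MD (described in the context) converges to a solution of $$\min_{\mathbf{x}\in\mathbb{R}^n}\ \frac12\|\mathbf{y}-\mathbf{M}\mathbf{A}\mathbf{x}\|_2^2+\lambda\sum_{i=1}^n\|\mathbf{D}_i\mathbf{x}\|_2 .$$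
   Context: $(\cdot)^*$ denotes transpose and $\mathbf{I}$ the identity. Elements of $\mathbb{R}^n$ are images on an $N_1\times N_2$ grid, $n=N_1N_2$, in lexicographic order. "Periodic convolution" means $(\mathbf{A}\mathbf{x})(r)=\sum_q h(r-q)\mathbf{x}(q)$ for some real kernel $h$, with pixel indices taken modulo $(N_1,N_2)$; equivalently $\mathbf{A}$ is block-circulant with circulant blocks. The two components of $\mathbf{D}_i\mathbf{x}$ are the first-order differences of $\mathbf{x}$ between pixel $i$ and its adjacent pixel in the horizontal, respectively vertical, direction (indices modulo the grid size, with a fixed forward or backward difference convention, the same at all pixels). $\mathbf{D}^h,\mathbf{D}^v\in\mathbb{R}^{n\times n}$ are the matrices collecting the first, respectively second, rows of $\mathbf{D}_1,\dots,\mathbf{D}_n$. Put $$\mathbf{K}=\bigl(\mu_1\mathbf{A}^*\mathbf{A}+\mu_2(\mathbf{D}^h)^*\mathbf{D}^h+\mu_2(\mathbf{D}^v)^*\mathbf{D}^v\bigr)^{-1}.$$ The vector soft-threshold is $\mathrm{vect\text{-}soft}(\mathbf{v},\gamma)=\frac{\mathbf{v}}{\|\mathbf{v}\|_2}\max\{\|\mathbf{v}\|_2-\gamma,0\}$ with the convention $\mathbf{0}/\|\mathbf{0}\|_2=\mathbf{0}$. Algorithm TV-MD (TV mask decoupling): choose $\mu_1,\mu_2>0$, $\mathbf{u}^{(1)}_0,\mathbf{d}^{(1)}_0\in\mathbb{R}^n$ and $\mathbf{u}^{(j)}_0,\mathbf{d}^{(j)}_0\in\mathbb{R}^2$ for $j=2,\dots,n+1$.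 For $k=0,1,2,\dots$ (run without stopping): set $\boldsymbol{\zeta}^{(j)}=\mathbf{u}^{(j)}_k+\mathbf{d}^{(j)}_k$ for $j=1,\dots,n+1$; let $\boldsymbol{\delta}^h,\boldsymbol{\delta}^v\in\mathbb{R}^n$ be the vectors of first, respectively second, components of $\boldsymbol{\zeta}^{(2)},\dots,\boldsymbol{\zeta}^{(n+1)}$; then $$\mathbf{z}_{k+1}=\mathbf{K}\bigl(\mu_1\mathbf{A}^*\boldsymbol{\zeta}^{(1)}+\mu_2(\mathbf{D}^h)^*\boldsymbol{\delta}^h+\mu_2(\mathbf{D}^v)^*\boldsymbol{\delta}^v\bigr),$$ $$\mathbf{u}^{(1)}_{k+1}=(\mathbf{M}^*\mathbf{M}+\mu_1\mathbf{I})^{-1}\bigl(\mathbf{M}^*\mathbf{y}+\mu_1(\mathbf{A}\mathbf{z}_{k+1}-\mathbf{d}^{(1)}_k)\bigr),\qquad \mathbf{d}^{(1)}_{k+1}=\mathbf{d}^{(1)}_k-(\mathbf{A}\mathbf{z}_{k+1}-\mathbf{u}^{(1)}_{k+1}),$$ and for $j=2,\dots,n+1$, $$\mathbf{u}^{(j)}_{k+1}=\mathrm{vect\text{-}soft}\bigl(\mathbf{D}_{j-1}\mathbf{z}_{k+1}-\mathbf{d}^{(j)}_k,\lambda/\mu_2\bigr),\qquad \mathbf{d}^{(j)}_{k+1}=\mathbf{d}^{(j)}_k-(\mathbf{D}_{j-1}\mathbf{z}_{k+1}-\mathbf{u}^{(j)}_{k+1}).$$ *)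

theory Defs
  imports "HOL-Analysis.Analysis" "Berlekamp_Zassenhaus.Finite_Field"
begin

text \<open>
  A pixel of an \<open>N\<^sub>1 \<times> N\<^sub>2\<close> grid is an element (row, column) of \<open>\<int>/N\<^sub>1 \<times> \<int>/N\<^sub>2\<close>, where
  \<open>N\<^sub>1 = CARD('a)\<close> and \<open>N\<^sub>2 = CARD('b)\<close> are arbitrary positive integers. Arithmetic on pixels is
  therefore arithmetic modulo \<open>(N\<^sub>1, N\<^sub>2)\<close>. Images and matrices are indexed by the pixels
  themselves instead of by their positions in lexicographic order.
\<close>

type_synonym ('a, 'b) pixel = "'a mod_ring \<times> 'b mod_ring"

definition periodic_convolution ::
    "real ^ ('a::finite, 'b::finite) pixel ^ ('a, 'b) pixel \<Rightarrow> bool" where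
  "periodic_convolution A \<longleftrightarrow>
     (\<exists>h :: ('a, 'b) pixel \<Rightarrow> real. \<forall>x r. (A *v x) $ r = (\<Sum>q\<in>UNIV. h (r - q) * x $ q))"

definition masking_matrix :: "real ^ 'n ^ 'm \<Rightarrow> bool" where
  "masking_matrix M \<longleftrightarrow>
     (\<exists>\<sigma> :: 'm \<Rightarrow> 'n. inj \<sigma> \<and> (\<forall>i. row i M = row (\<sigma> i) (mat 1)))"

text \<open>
  The unit steps are written with \<open>of_int_mod_ring\<close> because \<open>'a mod_ring\<close> has no constant \<open>1\<close>
  unless \<open>CARD('a) > 1\<close>; for a dimension of length 1 the step and the difference are zero.
\<close>

definition horizontal_step :: "('a::finite, 'b::finite) pixel" where
  "horizontal_step = (0, of_int_mod_ring 1)"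

definition vertical_step :: "('a::finite, 'b::finite) pixel" where
  "vertical_step = (of_int_mod_ring 1, 0)"

datatype difference_convention = Forward | Backward

text \<open>
  The row vector of the functional \<open>x \<mapsto> x(i + e) - x(i)\<close> (forward) or \<open>x \<mapsto> x(i) - x(i - e)\<close>
  (backward).
\<close>

fun difference_row ::
    "difference_convention \<Rightarrow> ('a::finite, 'b::finite) pixel \<Rightarrow> ('a, 'b) pixel
      \<Rightarrow> real ^ ('a, 'b) pixel" where
  "difference_row Forward e i = axis (i + e) 1 - axis i 1"
| "difference_row Backward e i = axis i 1 - axis (i - e) 1"

definition difference_matrix ::
    "difference_convention \<Rightarrow> difference_convention \<Rightarrow> ('a::finite, 'b::finite) pixel
      \<Rightarrow> real ^ ('a, 'b) pixel ^ 2" where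
  "difference_matrix ch cv i =
     vector [difference_row ch horizontal_step i, difference_row cv vertical_step i]"

text \<open>
  With \<open>l = 1\<close> and \<open>l = 2\<close> this is \<open>D\<^sup>h\<close> and \<open>D\<^sup>v\<close>, respectively.
\<close>

definition collect_rows :: "2 \<Rightarrow> ('n \<Rightarrow> real ^ 'n ^ 2) \<Rightarrow> real ^ 'n ^ 'n" where
  "collect_rows l D = (\<chi> i. row l (D i))"

text \<open>At \<open>v = 0\<close> the quotient \<open>v /\<^sub>R norm v\<close> is \<open>0\<close>, as the convention \<open>0/\<parallel>0\<parallel> = 0\<close> requires.\<close>

definition vect_soft :: "real ^ 'k \<Rightarrow> real \<Rightarrow> real ^ 'k" where
  "vect_soft v \<gamma> = max (norm v - \<gamma>) 0 *\<^sub>R (v /\<^sub>R norm v)"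

definition tv_objective ::
    "real ^ 'n ^ 'n \<Rightarrow> real ^ 'n ^ 'm \<Rightarrow> ('n \<Rightarrow> real ^ 'n ^ 2) \<Rightarrow> real ^ 'm \<Rightarrow> real
      \<Rightarrow> real ^ 'n \<Rightarrow> real" where
  "tv_objective A M D y lam x =
     1 / 2 * (norm (y - (M ** A) *v x))\<^sup>2 + lam * (\<Sum>i\<in>UNIV. norm (D i *v x))"

definition K_matrix ::
    "real ^ 'n ^ 'n \<Rightarrow> ('n \<Rightarrow> real ^ 'n ^ 2) \<Rightarrow> real \<Rightarrow> real \<Rightarrow> real ^ 'n ^ 'n" where
  "K_matrix A D \<mu>\<^sub>1 \<mu>\<^sub>2 =
     matrix_inv (\<mu>\<^sub>1 *\<^sub>R (transpose A ** A)
       + \<mu>\<^sub>2 *\<^sub>R (transpose (collect_rows 1 D) ** collect_rows 1 D)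
       + \<mu>\<^sub>2 *\<^sub>R (transpose (collect_rows 2 D) ** collect_rows 2 D))"

text \<open>
  The sequences \<open>u1\<close>, \<open>d1\<close> are the blocks with index \<open>j = 1\<close>; \<open>u k i\<close> and \<open>d k i\<close> are the blocks
  with index \<open>j = i + 1\<close> after \<open>k\<close> steps, \<open>i\<close> being a pixel. The initial values \<open>u1 0\<close>, \<open>d1 0\<close>,
  \<open>u 0\<close>, \<open>d 0\<close> are unconstrained and determine all later terms; \<open>z 0\<close> is never used.
\<close>

definition TV_MD ::
    "real ^ 'n ^ 'n \<Rightarrow> real ^ 'n ^ 'm \<Rightarrow> ('n \<Rightarrow> real ^ 'n ^ 2) \<Rightarrow> real ^ 'm \<Rightarrow> real
      \<Rightarrow> real \<Rightarrow> real
      \<Rightarrow> (nat \<Rightarrow> real ^ 'n) \<Rightarrow> (nat \<Rightarrow> real ^ 'n) \<Rightarrow> (nat \<Rightarrow> real ^ 'n)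
      \<Rightarrow> (nat \<Rightarrow> 'n \<Rightarrow> real ^ 2) \<Rightarrow> (nat \<Rightarrow> 'n \<Rightarrow> real ^ 2) \<Rightarrow> bool" where
  "TV_MD A M D y lam \<mu>\<^sub>1 \<mu>\<^sub>2 z u1 d1 u d \<longleftrightarrow> (\<forall>k.
     (let \<zeta>1 = u1 k + d1 k;
          \<zeta> = (\<lambda>i. u k i + d k i);
          \<delta>h = (\<chi> i. \<zeta> i $ 1);
          \<delta>v = (\<chi> i. \<zeta> i $ 2)
      in z (Suc k) = K_matrix A D \<mu>\<^sub>1 \<mu>\<^sub>2 *v
           (\<mu>\<^sub>1 *\<^sub>R (transpose A *v \<zeta>1)
            + \<mu>\<^sub>2 *\<^sub>R (transpose (collect_rows 1 D) *v \<delta>h)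
            + \<mu>\<^sub>2 *\<^sub>R (transpose (collect_rows 2 D) *v \<delta>v))) \<and>
     u1 (Suc k) = matrix_inv (transpose M ** M + \<mu>\<^sub>1 *\<^sub>R mat 1) *v
       (transpose M *v y + \<mu>\<^sub>1 *\<^sub>R (A *v z (Suc k) - d1 k)) \<and>
     d1 (Suc k) = d1 k - (A *v z (Suc k) - u1 (Suc k)) \<and>
     (\<forall>i. u (Suc k) i = vect_soft (D i *v z (Suc k) - d k i) (lam / \<mu>\<^sub>2) \<and>
          d (Suc k) i = d k i - (D i *v z (Suc k) - u (Suc k) i)))"

end

theory Submission
  imports Defs
begin

text \<open>
  After rescaling the blocks, the algorithm is ADMM for minimizing \<open>g \<circ> G\<close>, where \<open>G\<close> stacks \<open>A\<close>
  and the \<open>D\<^sub>i\<close> and \<open>g\<close> is convex and finite. The difference \<open>u - d\<close> is the iterate of the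
  Douglas-Rachford map, which is Fejer monotone with respect to every pair of a minimizer and a
  multiplier; such a pair exists by a separation argument. The steps therefore tend to zero, every
  cluster point is itself such a pair, and Fejer monotonicity with respect to this pair turns
  subsequential into full convergence. The assumption on the constant image gives coercivity of the
  objective and injectivity of \<open>G\<close>, because the common kernel of the \<open>D\<^sub>i\<close> consists of the constant
  images.
\<close>

section \<open>Subgradients and Fermat's rule\<close>

definition subdifferential :: "('a::real_inner \<Rightarrow> real) \<Rightarrow> 'a \<Rightarrow> 'a set" where
  "subdifferential g u = {p. \<forall>v. g u + p \<bullet> (v - u) \<le> g v}"

lemma subdifferentialD: "p \<in> subdifferential g u \<Longrightarrow> g u + p \<bullet> (v - u) \<le> g v"
  by (simp add: subdifferential_def)

lemma subdifferential_monotone: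
  assumes "p \<in> subdifferential g u" "q \<in> subdifferential g v"
  shows "0 \<le> (p - q) \<bullet> (u - v)"
  using subdifferentialD[OF assms(1), of v] subdifferentialD[OF assms(2), of u]
  by (simp add: inner_diff_left inner_diff_right)

text \<open>For each fixed \<open>v\<close> the subgradient inequality passes to the limit. Through
  this, cluster points of the iteration inherit the multiplier condition.\<close>

lemma subdifferential_closed:
  assumes "continuous_on UNIV g" "u \<longlonglongrightarrow> u'" "p \<longlonglongrightarrow> p'"
    and "\<And>k. p k \<in> subdifferential g (u k)"
  shows "p' \<in> subdifferential g u'"
  unfolding subdifferential_def
proof safe
  fix v
  have "(\<lambda>k. g (u k)) \<longlonglongrightarrow> g u'"
    using assms(1,2) continuous_on_tendsto_compose by fastforce
  then have "(\<lambda>k. g (u k) + p k \<bullet> (v - u k)) \<longlonglongrightarrow> g u' + p' \<bullet> (v - u')"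
    by (intro tendsto_intros assms)
  then show "g u' + p' \<bullet> (v - u') \<le> g v"
    by (rule LIMSEQ_le_const2) (use assms(4) subdifferentialD in blast)
qed

text \<open>
  Fermat's rule for \<open>g \<circ> G\<close>. The multiplier is the slope of a hyperplane that separates the
  strict epigraph of \<open>g\<close> from the range of \<open>G\<close> at height \<open>g (G x)\<close>; it is not vertical because
  \<open>g\<close> is finite everywhere.
\<close>

lemma minimizer_imp_multiplier:
  fixes G :: "'x::euclidean_space \<Rightarrow> 'w::euclidean_space"
  assumes G: "linear G" and g: "convex_on UNIV g"
    and min: "\<And>x'. g (G x) \<le> g (G x')"
  obtains p where "p \<in> subdifferential g (G x)" "\<And>h. p \<bullet> G h = 0"
proof -
  let ?S = "range (\<lambda>x'. (G x', g (G x)))" and ?T = "{(w, t). g w < t}"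
  have S: "?S = range G \<times> {g (G x)}" by auto
  have "convex ?S"
    unfolding S using G by (intro convex_Times convex_linear_image) auto
  moreover have "convex ?T"
  proof (rule convexI; clarsimp)
    fix v w :: 'w and s t a b :: real
    assume *: "g v < s" "g w < t" "0 \<le> a" "0 \<le> b" "a + b = 1"
    have "g (a *\<^sub>R v + b *\<^sub>R w) \<le> a * g v + b * g w"
      using g * unfolding convex_on_def by blast
    also have "\<dots> < a * s + b * t"
      using * by (cases "a = 0") (auto intro!: add_less_le_mono mult_left_mono)
    finally show "g (a *\<^sub>R v + b *\<^sub>R w) < a * s + b * t" .
  qed
  moreover have "(G x, g (G x) + 1) \<in> ?T" by simp
  then have "?T \<noteq> {}" by blast
  moreover have "?S \<inter> ?T = {}" using min by (auto simp flip: not_le)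
  ultimately obtain a b where ab: "a \<noteq> 0" "\<forall>v\<in>?S. a \<bullet> v \<le> b" "\<forall>v\<in>?T. a \<bullet> v \<ge> b"
    using separating_hyperplane_sets[of ?S ?T] by auto
  obtain q \<tau> where a: "a = (q, \<tau>)" by (cases a)
  have S_le: "q \<bullet> G x' + \<tau> * g (G x) \<le> b" for x'
    using ab(2) by (auto simp: a)
  have T_ge: "b \<le> q \<bullet> w + \<tau> * t" if "g w < t" for w t
    using ab(3) that by (auto simp: a)
  have q0: "q \<bullet> G h = 0" for h
  proof (rule ccontr)
    assume nz: "q \<bullet> G h \<noteq> 0"
    \<comment> \<open>A linear functional bounded above on the range of \<open>G\<close> must vanish
      there: this multiple of \<open>h\<close> would raise the left side of \<open>S_le\<close> to
      \<open>b + 1\<close>.\<close>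
    define c where "c = (b - \<tau> * g (G x) + 1) / (q \<bullet> G h)"
    have "q \<bullet> G (c *\<^sub>R h) = b - \<tau> * g (G x) + 1"
      using nz by (simp add: linear_scale[OF G] c_def)
    then show False using S_le[of "c *\<^sub>R h"] by simp
  qed
  have \<tau>_le: "\<tau> * g (G x) \<le> q \<bullet> w + \<tau> * t" if "g w < t" for w t
    using T_ge[OF that] S_le[of 0] by (simp add: q0)
  have "0 \<le> \<tau>"
    using \<tau>_le[of "G x" "g (G x) + 1"] by (simp add: q0 distrib_left)
  \<comment> \<open>A vertical hyperplane would make \<open>q\<close> nonnegative in every
    direction, hence zero, and the normal \<open>a\<close> would vanish.\<close>
  moreover have "\<tau> \<noteq> 0"
  proof
    assume "\<tau> = 0"
    then have "0 \<le> q \<bullet> (- q)" using \<tau>_le[of "- q" "g (- q) + 1"] by simp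
    then have "q = 0" by (simp add: inner_gt_zero_iff flip: not_less)
    with ab(1) \<open>\<tau> = 0\<close> show False by (simp add: a zero_prod_def)
  qed
  ultimately have "0 < \<tau>" by simp
  \<comment> \<open>The epigraph is strict, so the height \<open>g w\<close> is only approached, by
    \<open>g w + e\<close>.\<close>
  have "g (G x) \<le> (q \<bullet> w) / \<tau> + g w" for w
  proof (rule field_le_epsilon)
    fix e :: real assume "0 < e"
    then have "\<tau> * g (G x) \<le> q \<bullet> w + \<tau> * (g w + e)" by (intro \<tau>_le) simp
    then show "g (G x) \<le> (q \<bullet> w) / \<tau> + g w + e"
      using \<open>0 < \<tau>\<close> by (simp add: field_simps)
  qed
  then have "- q /\<^sub>R \<tau> \<in> subdifferential g (G x)"
    by (auto simp: subdifferential_def inner_diff_right q0 field_simps)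
  moreover have "(- q /\<^sub>R \<tau>) \<bullet> G h = 0" for h by (simp add: q0)
  ultimately show thesis by (rule that)
qed

lemma multiplier_imp_minimizer:
  assumes "linear G" "p \<in> subdifferential g (G x)" "\<And>h. p \<bullet> G h = 0"
  shows "g (G x) \<le> g (G x')"
  using subdifferentialD[OF assms(2), of "G x'"] assms(3)[of "x' - x"]
  by (simp add: linear_diff[OF assms(1)])

section \<open>Convergence of ADMM\<close>

text \<open>The orthogonality turns the first left side into exactly the sum of the squared norms of
  \<open>a\<close> and \<open>b\<close>; the sign of \<open>a \<bullet> b\<close> then bounds this
  sum by the right side. In the application \<open>a\<close>, \<open>b\<close>, \<open>p\<close> are
  the deviations of \<open>u\<close>, \<open>d\<close> and the next \<open>G z\<close> from a
  solution pair.\<close>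

lemma douglas_rachford_step:
  fixes a b p :: "'a::real_inner"
  assumes "(p - (a + b)) \<bullet> p = 0" "a \<bullet> b \<le> 0"
  shows "(norm (p - b))\<^sup>2 + (norm (p - a))\<^sup>2 \<le> (norm (a - b))\<^sup>2"
    and "(norm a)\<^sup>2 + (norm b)\<^sup>2 \<le> (norm (a - b))\<^sup>2"
  using assms by (simp_all add: power2_norm_eq_inner algebra_simps inner_commute)

lemma tendsto_zero_norm_power2_bound:
  assumes "b \<longlonglongrightarrow> 0" "\<And>k. (norm (f k))\<^sup>2 \<le> b k"
  shows "f \<longlonglongrightarrow> 0"
proof -
  have "(\<lambda>k. (norm (f k))\<^sup>2) \<longlonglongrightarrow> 0"
    by (rule tendsto_sandwich[OF _ _ tendsto_const assms(1)]) (use assms(2) in auto)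
  then have "(\<lambda>k. sqrt ((norm (f k))\<^sup>2)) \<longlonglongrightarrow> sqrt 0" by (rule tendsto_real_sqrt)
  then show ?thesis by (simp add: tendsto_norm_zero_iff)
qed

text \<open>The updates enter only through their optimality conditions: \<open>z_step\<close> is the
  normal equation for fitting \<open>G z\<close> to \<open>u + d\<close>, while
  \<open>u_step\<close> with \<open>d_step\<close> says that \<open>u (Suc k)\<close> is the
  proximal point of \<open>g\<close> at \<open>G (z (Suc k)) - d k\<close>. Hence multipliers appear
  below with the sign \<open>- e\<close>.\<close>

theorem admm_converges:
  fixes G :: "'x::euclidean_space \<Rightarrow> 'w::euclidean_space"
  assumes G: "linear G" "inj G" and g: "convex_on UNIV g"
    and ex_min: "\<exists>x. \<forall>x'. g (G x) \<le> g (G x')"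
    and z_step: "\<And>k h. (G (z (Suc k)) - (u k + d k)) \<bullet> G h = 0"
    and u_step: "\<And>k. - d (Suc k) \<in> subdifferential g (u (Suc k))"
    and d_step: "\<And>k. d (Suc k) = d k - (G (z (Suc k)) - u (Suc k))"
  shows "\<exists>x. (\<forall>x'. g (G x) \<le> g (G x')) \<and> z \<longlonglongrightarrow> x"
proof -
  \<comment> \<open>The index starts at one because the arbitrary \<open>u 0\<close> and
    \<open>d 0\<close> need not satisfy the subgradient relation.\<close>
  define q where "q k = u (Suc k) - d (Suc k)" for k
  have cont: "continuous_on UNIV g"
    using g by (simp add: convex_on_continuous)
  have fejer: "(norm (q (Suc k) - (G x - e)))\<^sup>2 + (norm (G (z (Suc (Suc k))) - u (Suc k)))\<^sup>2
        \<le> (norm (q k - (G x - e)))\<^sup>2" (is ?A)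
    "(norm (u (Suc k) - G x))\<^sup>2 + (norm (d (Suc k) - e))\<^sup>2 \<le> (norm (q k - (G x - e)))\<^sup>2" (is ?B)
    if e: "- e \<in> subdifferential g (G x)" "\<And>h. e \<bullet> G h = 0" for x e k
  proof -
    define a b p where "a = u (Suc k) - G x" and "b = d (Suc k) - e"
      and "p = G (z (Suc (Suc k))) - G x"
    have "p = G (z (Suc (Suc k)) - x)" by (simp add: p_def linear_diff[OF G(1)])
    \<comment> \<open>The extra \<open>e\<close> is orthogonal to the range of \<open>G\<close>, so
      the normal equation survives the shift.\<close>
    moreover have "p - (a + b) = (G (z (Suc (Suc k))) - (u (Suc k) + d (Suc k))) + e"
      by (simp add: p_def a_def b_def)
    ultimately have orth: "(p - (a + b)) \<bullet> p = 0"
      by (simp only: inner_add_left z_step e(2))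
    have mono: "a \<bullet> b \<le> 0"
      using subdifferential_monotone[OF u_step[of k] e(1)]
      by (simp add: a_def b_def inner_diff_left inner_diff_right inner_commute)
    \<comment> \<open>By the update of \<open>d\<close>,
      \<open>q (Suc k) = G (z (Suc (Suc k))) - d (Suc k)\<close>; thus \<open>a - b\<close> and
      \<open>p - b\<close> are the deviations before and after one step.\<close>
    have eqs: "p - b = q (Suc k) - (G x - e)" "a - b = q k - (G x - e)"
      "p - a = G (z (Suc (Suc k))) - u (Suc k)"
      by (simp_all add: p_def a_def b_def q_def d_step[of "Suc k"])
    show ?A using douglas_rachford_step(1)[OF orth mono] by (simp only: eqs)
    show ?B using douglas_rachford_step(2)[OF orth mono] by (simp only: eqs a_def[symmetric] b_def[symmetric])
  qed
  have V_conv: "\<exists>L. (\<lambda>k. (norm (q k - (G x - e)))\<^sup>2) \<longlonglongrightarrow> L"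
    and V_le: "(norm (q k - (G x - e)))\<^sup>2 \<le> (norm (q 0 - (G x - e)))\<^sup>2"
    if e: "- e \<in> subdifferential g (G x)" "\<And>h. e \<bullet> G h = 0" for x e k
  proof -
    have dec: "decseq (\<lambda>k. (norm (q k - (G x - e)))\<^sup>2)"
      by (rule decseq_SucI) (use fejer(1)[OF e] in \<open>smt (verit) zero_le_power2\<close>)
    then show "\<exists>L. (\<lambda>k. (norm (q k - (G x - e)))\<^sup>2) \<longlonglongrightarrow> L"
      using decseq_convergent[of _ 0] by (metis zero_le_power2)
    show "(norm (q k - (G x - e)))\<^sup>2 \<le> (norm (q 0 - (G x - e)))\<^sup>2"
      using decseqD[OF dec, of 0 k] by simp
  qed
  obtain xs where xs: "\<And>x'. g (G xs) \<le> g (G x')" using ex_min by blast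
  obtain p where "p \<in> subdifferential g (G xs)" "\<And>h. p \<bullet> G h = 0"
    using minimizer_imp_multiplier[OF G(1) g xs] by blast
  then obtain es where es: "- es \<in> subdifferential g (G xs)" "\<And>h. es \<bullet> G h = 0"
    by (metis add.inverse_inverse inner_minus_left neg_0_equal_iff_equal)
  let ?r = "\<lambda>k. G (z (Suc (Suc k))) - u (Suc k)"
  \<comment> \<open>The squared residual is at most the decrease of a convergent sequence.\<close>
  have r0: "?r \<longlonglongrightarrow> 0"
  proof -
    obtain L where L: "(\<lambda>k. (norm (q k - (G xs - es)))\<^sup>2) \<longlonglongrightarrow> L"
      using V_conv[OF es] by blast
    have lim: "(\<lambda>k. (norm (q k - (G xs - es)))\<^sup>2 - (norm (q (Suc k) - (G xs - es)))\<^sup>2) \<longlonglongrightarrow> 0"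
      using tendsto_diff[OF L LIMSEQ_Suc[OF L]] by simp
    show ?thesis
      by (rule tendsto_zero_norm_power2_bound[OF lim]) (use fejer(1)[OF es] in \<open>simp add: algebra_simps\<close>)
  qed
  \<comment> \<open>A bound on \<open>q\<close> controls only the difference of \<open>u\<close> and
    \<open>d\<close>; the second Fejer estimate bounds both, which gives a joint cluster
    point.\<close>
  have "bounded (range (\<lambda>k. (u (Suc k) - G xs, d (Suc k) - es)))"
    unfolding bounded_iff
  proof (intro exI ballI, clarify)
    fix k
    show "norm (u (Suc k) - G xs, d (Suc k) - es) \<le> norm (q 0 - (G xs - es))"
      unfolding norm_Pair
      by (intro real_le_lsqrt order_trans[OF fejer(2)[OF es] V_le[OF es]]) simp
  qed
  then obtain l \<rho> where \<rho>: "strict_mono (\<rho> :: nat \<Rightarrow> nat)"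
      "((\<lambda>k. (u (Suc k) - G xs, d (Suc k) - es)) \<circ> \<rho>) \<longlonglongrightarrow> l"
    using bounded_imp_convergent_subsequence by blast
  define ub eb where "ub = fst l + G xs" and "eb = snd l + es"
  have u_sub: "(\<lambda>j. u (Suc (\<rho> j))) \<longlonglongrightarrow> ub"
    using tendsto_add[OF tendsto_fst[OF \<rho>(2)] tendsto_const[of "G xs"]]
    by (simp add: ub_def o_def)
  have d_sub: "(\<lambda>j. d (Suc (\<rho> j))) \<longlonglongrightarrow> eb"
    using tendsto_add[OF tendsto_snd[OF \<rho>(2)] tendsto_const[of es]]
    by (simp add: eb_def o_def)
  have r_sub: "(\<lambda>j. ?r (\<rho> j)) \<longlonglongrightarrow> 0"
    using LIMSEQ_subseq_LIMSEQ[OF r0 \<rho>(1)] by (simp add: o_def)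
  have "(\<lambda>j. G (z (Suc (Suc (\<rho> j))))) \<longlonglongrightarrow> ub"
    using tendsto_add[OF r_sub u_sub] by simp
  \<comment> \<open>The range is a subspace of a finite-dimensional space, so the limit of the
    vectors \<open>G z\<close> stays in it.\<close>
  moreover have "closed (range G)"
    using G(1) by (intro closed_subspace linear_subspace_image) auto
  ultimately have "ub \<in> range G"
    by (rule closed_sequentially[rotated, rotated]) auto
  then obtain xb where xb: "ub = G xb" by blast
  have eb_sub: "- eb \<in> subdifferential g (G xb)"
    by (rule subdifferential_closed[OF cont u_sub[unfolded xb] tendsto_minus[OF d_sub]])
      (rule u_step)
  \<comment> \<open>The normal equation makes \<open>?r k - d (Suc k)\<close> orthogonal to the
    range of \<open>G\<close>, and the residual vanishes in the limit.\<close>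
  have eb_orth: "eb \<bullet> G h = 0" for h
  proof -
    have "(\<lambda>j. (?r (\<rho> j) - d (Suc (\<rho> j))) \<bullet> G h) \<longlonglongrightarrow> (0 - eb) \<bullet> G h"
      by (intro tendsto_intros r_sub d_sub)
    moreover have "(?r k - d (Suc k)) \<bullet> G h = 0" for k
      using z_step[of "Suc k" h] by (simp add: diff_diff_eq)
    ultimately show ?thesis by (simp add: LIMSEQ_const_iff)
  qed
  \<comment> \<open>The distances to the cluster pair converge by monotonicity and tend to zero
    along \<open>\<rho>\<close>, so their full limit is zero.\<close>
  have V0: "(\<lambda>k. (norm (q k - (G xb - eb)))\<^sup>2) \<longlonglongrightarrow> 0"
  proof -
    obtain L where L: "(\<lambda>k. (norm (q k - (G xb - eb)))\<^sup>2) \<longlonglongrightarrow> L"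
      using V_conv[OF eb_sub eb_orth] by blast
    have "(\<lambda>j. (norm (q (\<rho> j) - (G xb - eb)))\<^sup>2) \<longlonglongrightarrow> (norm (ub - eb - (G xb - eb)))\<^sup>2"
      unfolding q_def by (intro tendsto_intros u_sub d_sub)
    from LIMSEQ_unique[OF this LIMSEQ_subseq_LIMSEQ[OF L \<rho>(1), unfolded o_def]] have "L = 0"
      by (simp add: xb)
    with L show ?thesis by simp
  qed
  have "(\<lambda>k. u (Suc k) - G xb) \<longlonglongrightarrow> 0"
    by (rule tendsto_zero_norm_power2_bound[OF V0], rule order_trans[OF _ fejer(2)[OF eb_sub eb_orth]])
      simp
  from tendsto_add[OF r0 this] have "(\<lambda>k. G (z (Suc (Suc k)) - xb)) \<longlonglongrightarrow> 0"
    by (simp add: linear_diff[OF G(1)])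
  then have Gz: "(\<lambda>k. norm (G (z (Suc (Suc k)) - xb))) \<longlonglongrightarrow> 0"
    by (rule tendsto_norm_zero)
  \<comment> \<open>Injectivity bounds \<open>G\<close> below, which transfers convergence from
    \<open>G z\<close> to \<open>z\<close>.\<close>
  obtain B where B: "B > 0" "\<And>x. B * norm x \<le> norm (G x)"
    using linear_inj_bounded_below_pos[OF G] by blast
  have "(\<lambda>k. z (Suc (Suc k)) - xb) \<longlonglongrightarrow> 0"
    by (rule Lim_null_comparison[OF _ tendsto_divide_zero[OF Gz, of B]])
      (use B in \<open>auto simp: field_simps\<close>)
  then have "(\<lambda>k. z (k + 2)) \<longlonglongrightarrow> xb" by (simp add: LIM_zero_iff)
  then have "z \<longlonglongrightarrow> xb" by (rule LIMSEQ_offset)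
  moreover have "g (G xb) \<le> g (G x')" for x'
    using multiplier_imp_minimizer[OF G(1) eb_sub] by (simp add: eb_orth)
  ultimately show ?thesis by blast
qed

section \<open>Convexity of the building blocks\<close>

lemma convex_on_norm_power2: "convex_on UNIV (\<lambda>x :: 'a::real_inner. (norm x)\<^sup>2)"
proof (rule convex_onI)
  fix t :: real and x y :: 'a
  assume t: "0 < t" "t < 1"
  have "(1 - t) * (norm x)\<^sup>2 + t * (norm y)\<^sup>2 - (norm ((1 - t) *\<^sub>R x + t *\<^sub>R y))\<^sup>2
      = t * (1 - t) * (norm (x - y))\<^sup>2"
    by (simp add: power2_norm_eq_inner algebra_simps inner_commute)
  moreover have "0 \<le> t * (1 - t) * (norm (x - y))\<^sup>2" using t by simp
  ultimately show "(norm ((1 - t) *\<^sub>R x + t *\<^sub>R y))\<^sup>2 \<le> (1 - t) * (norm x)\<^sup>2 + t * (norm y)\<^sup>2"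
    by linarith
qed simp

lemma convex_on_compose_affine:
  assumes "convex_on UNIV f" "linear L"
  shows "convex_on UNIV (\<lambda>x. f (c + L x))"
proof (rule convex_onI)
  fix t :: real and x y
  assume t: "0 < t" "t < 1"
  have "c + L ((1 - t) *\<^sub>R x + t *\<^sub>R y) = (1 - t) *\<^sub>R (c + L x) + t *\<^sub>R (c + L y)"
    by (simp only: linear_add[OF assms(2)] linear_scale[OF assms(2)]) (simp add: algebra_simps)
  then show "f (c + L ((1 - t) *\<^sub>R x + t *\<^sub>R y)) \<le> (1 - t) * f (c + L x) + t * f (c + L y)"
    using convex_onD[OF assms(1), of t] t by simp
qed simp

lemma convex_on_sum_functions:
  assumes "finite I" "\<And>i. i \<in> I \<Longrightarrow> convex_on UNIV (f i)"
  shows "convex_on UNIV (\<lambda>x. \<Sum>i\<in>I. f i x)"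
  using assms by (induction I rule: finite_induct) (auto simp: convex_on_const intro!: convex_on_add)

section \<open>Normal equation of the z-update\<close>

text \<open>\<open>matrix_inv\<close> is a choice that is meaningful only for invertible matrices;
  for a square matrix the trivial kernel supplies invertibility.\<close>

lemma matrix_inv_solves:
  fixes S :: "real ^ 'n ^ 'n"
  assumes "\<And>x. S *v x = 0 \<Longrightarrow> x = 0"
  shows "S *v (matrix_inv S *v b) = b"
proof -
  have "invertible S"
    using assms invertible_left_inverse matrix_left_invertible_ker by blast
  then have "S ** matrix_inv S = mat 1"
    unfolding invertible_def matrix_inv_def by (metis (mono_tags, lifting) someI_ex)
  then show ?thesis by (simp add: matrix_vector_mul_assoc)
qed

lemma inner_transpose_matrix:
  fixes B :: "real ^ 'n ^ 'm"
  shows "(transpose B *v w) \<bullet> h = w \<bullet> (B *v h)"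
  by (simp add: dot_lmul_matrix)

lemma inner_gram_matrix:
  fixes B :: "real ^ 'n ^ 'm"
  shows "((transpose B ** B) *v x) \<bullet> h = (B *v x) \<bullet> (B *v h)"
  by (simp add: inner_transpose_matrix flip: matrix_vector_mul_assoc del: transpose_matrix_vector)

lemma collect_rows_mult: "collect_rows l D *v x = (\<chi> i. (D i *v x) $ l)"
  by (simp add: vec_eq_iff matrix_vector_mul_component collect_rows_def row_def)

text \<open>Regroups the pixelwise products by component, to pass between the blocks
  \<open>D i\<close> and the two stacked difference matrices.\<close>

lemma sum_inner_collect_rows:
  "(\<Sum>i\<in>UNIV. w i \<bullet> (D i *v h)) =
     (\<chi> i. w i $ 1) \<bullet> (collect_rows 1 D *v h) + (\<chi> i. w i $ 2) \<bullet> (collect_rows 2 D *v h)"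
  by (simp add: collect_rows_mult inner_vec_def sum_2 sum.distrib)

text \<open>This is the vanishing derivative, in direction \<open>h\<close>, of the weighted
  least-squares fit of \<open>A *v x\<close> to \<open>\<zeta>\<^sub>1\<close> and of each
  \<open>D i *v x\<close> to \<open>\<zeta> i\<close>. The system matrix is positive definite
  because \<open>A\<close> and the \<open>D i\<close> have no common kernel vector except
  zero.\<close>

lemma K_matrix_normal_equation:
  assumes inj: "\<And>x. A *v x = 0 \<Longrightarrow> (\<And>i. D i *v x = 0) \<Longrightarrow> x = 0"
    and \<mu>: "\<mu>\<^sub>1 > 0" "\<mu>\<^sub>2 > 0"
    and x: "x = K_matrix A D \<mu>\<^sub>1 \<mu>\<^sub>2 *v
           (\<mu>\<^sub>1 *\<^sub>R (transpose A *v \<zeta>\<^sub>1)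
            + \<mu>\<^sub>2 *\<^sub>R (transpose (collect_rows 1 D) *v (\<chi> i. \<zeta> i $ 1))
            + \<mu>\<^sub>2 *\<^sub>R (transpose (collect_rows 2 D) *v (\<chi> i. \<zeta> i $ 2)))"
  shows "\<mu>\<^sub>1 * ((A *v x - \<zeta>\<^sub>1) \<bullet> (A *v h))
      + \<mu>\<^sub>2 * (\<Sum>i\<in>UNIV. (D i *v x - \<zeta> i) \<bullet> (D i *v h)) = 0"
proof -
  define S where "S = \<mu>\<^sub>1 *\<^sub>R (transpose A ** A)
       + \<mu>\<^sub>2 *\<^sub>R (transpose (collect_rows 1 D) ** collect_rows 1 D)
       + \<mu>\<^sub>2 *\<^sub>R (transpose (collect_rows 2 D) ** collect_rows 2 D)"
  have S: "(S *v v) \<bullet> h = \<mu>\<^sub>1 * ((A *v v) \<bullet> (A *v h))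
      + \<mu>\<^sub>2 * (\<Sum>i\<in>UNIV. (D i *v v) \<bullet> (D i *v h))" for v h
    unfolding sum_inner_collect_rows S_def
    by (simp add: matrix_vector_mult_add_rdistrib inner_add_left inner_gram_matrix
        collect_rows_mult distrib_left flip: scaleR_matrix_vector_assoc)
  have "v = 0" if "S *v v = 0" for v
  proof -
    have "\<mu>\<^sub>1 * ((A *v v) \<bullet> (A *v v)) + \<mu>\<^sub>2 * (\<Sum>i\<in>UNIV. (D i *v v) \<bullet> (D i *v v)) = 0"
      using S[of v v] that by simp
    moreover have "0 \<le> \<mu>\<^sub>1 * ((A *v v) \<bullet> (A *v v))"
      "0 \<le> \<mu>\<^sub>2 * (\<Sum>i\<in>UNIV. (D i *v v) \<bullet> (D i *v v))"
      using \<mu> by (intro mult_nonneg_nonneg sum_nonneg; simp)+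
    ultimately have "\<mu>\<^sub>1 * ((A *v v) \<bullet> (A *v v)) = 0"
      "\<mu>\<^sub>2 * (\<Sum>i\<in>UNIV. (D i *v v) \<bullet> (D i *v v)) = 0" by linarith+
    then have "A *v v = 0" "D i *v v = 0" for i
      using \<mu> by (simp_all add: sum_nonneg_eq_0_iff)
    then show "v = 0" by (rule inj)
  qed
  then have "(S *v x) \<bullet> h = (\<mu>\<^sub>1 *\<^sub>R (transpose A *v \<zeta>\<^sub>1)
            + \<mu>\<^sub>2 *\<^sub>R (transpose (collect_rows 1 D) *v (\<chi> i. \<zeta> i $ 1))
            + \<mu>\<^sub>2 *\<^sub>R (transpose (collect_rows 2 D) *v (\<chi> i. \<zeta> i $ 2))) \<bullet> h"
    unfolding x K_matrix_def S_def[symmetric] by (simp only: matrix_inv_solves)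
  also have "\<dots> = \<mu>\<^sub>1 * (\<zeta>\<^sub>1 \<bullet> (A *v h)) + \<mu>\<^sub>2 * (\<Sum>i\<in>UNIV. \<zeta> i \<bullet> (D i *v h))"
    unfolding sum_inner_collect_rows
    by (simp add: inner_add_left inner_transpose_matrix distrib_left del: transpose_matrix_vector)
  finally show ?thesis
    unfolding S by (simp add: inner_diff_left sum_subtractf right_diff_distrib)
qed

section \<open>Proximal steps of the u-updates\<close>

text \<open>Soft thresholding is the proximal map of \<gamma> times the norm, so its residual is a
  subgradient there: \<open>v\<close> itself, of norm at most \<gamma>, below the threshold, and
  \<gamma> times the unit vector along \<open>v\<close> above it.\<close>

lemma vect_soft_subgradient:
  assumes "0 \<le> \<gamma>"
  shows "\<gamma> * norm (vect_soft v \<gamma>) + (v - vect_soft v \<gamma>) \<bullet> (w - vect_soft v \<gamma>) \<le> \<gamma> * norm w"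
proof (cases "norm v \<le> \<gamma>")
  case True
  then have "vect_soft v \<gamma> = 0" by (simp add: vect_soft_def)
  moreover have "v \<bullet> w \<le> \<gamma> * norm w"
    using norm_cauchy_schwarz[of v w] mult_right_mono[OF True, of "norm w"] by simp
  ultimately show ?thesis by simp
next
  case False
  define n where "n = v /\<^sub>R norm v"
  have "v \<noteq> 0" using False assms by auto
  then have n: "norm n = 1" "v = norm v *\<^sub>R n" by (simp_all add: n_def)
  have u: "vect_soft v \<gamma> = (norm v - \<gamma>) *\<^sub>R n"
    using False by (simp add: vect_soft_def n_def)
  have vu: "v - vect_soft v \<gamma> = \<gamma> *\<^sub>R n"
    unfolding u by (subst n(2)) (simp add: scaleR_diff_left)
  have "n \<bullet> n = 1" using n(1) by (simp add: norm_eq_1)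
  then have "n \<bullet> vect_soft v \<gamma> = norm v - \<gamma>" "norm (vect_soft v \<gamma>) = norm v - \<gamma>"
    unfolding u using False n(1) by simp_all
  moreover have "\<gamma> * (n \<bullet> w) \<le> \<gamma> * norm w"
    using norm_cauchy_schwarz[of n w] n(1) assms by (intro mult_left_mono) auto
  ultimately show ?thesis
    unfolding vu by (simp add: inner_diff_right right_diff_distrib)
qed

text \<open>The gap between the two sides is half the squared norm of
  \<open>M *v v - M *v u\<close>.\<close>

lemma least_squares_subgradient:
  fixes M :: "real ^ 'n ^ 'm"
  shows "1/2 * (norm (y - M *v u))\<^sup>2 + (transpose M *v (M *v u - y)) \<bullet> (v - u)
    \<le> 1/2 * (norm (y - M *v v))\<^sup>2"
proof -
  have "0 \<le> (norm (M *v v - M *v u))\<^sup>2" by simp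
  then show ?thesis
    unfolding inner_transpose_matrix
    by (simp add: power2_norm_eq_inner inner_diff_left inner_diff_right inner_commute
        matrix_vector_mult_diff_distrib algebra_simps)
qed

text \<open>The normal equation is arranged so that the gradient of the data term stands alone; with
  \<open>w = A z - d\<close> the right side becomes a multiple of the updated
  \<open>d\<close>.\<close>

lemma ridge_solution:
  fixes M :: "real ^ 'n ^ 'm"
  assumes "\<mu> > 0"
    and u: "u = matrix_inv (transpose M ** M + \<mu> *\<^sub>R mat 1) *v (transpose M *v y + \<mu> *\<^sub>R w)"
  shows "transpose M *v (M *v u - y) = \<mu> *\<^sub>R (w - u)"
proof -
  define S where "S = transpose M ** M + \<mu> *\<^sub>R (mat 1 :: real ^ 'n ^ 'n)"
  have S: "S *v x = transpose M *v (M *v x) + \<mu> *\<^sub>R x" for x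
    unfolding S_def
    by (simp add: matrix_vector_mult_add_rdistrib matrix_vector_mul_assoc del: transpose_matrix_vector
        flip: scaleR_matrix_vector_assoc)
  have "x = 0" if "S *v x = 0" for x
  proof -
    have "(S *v x) \<bullet> x = (M *v x) \<bullet> (M *v x) + \<mu> * (x \<bullet> x)"
      by (simp only: S inner_add_left inner_transpose_matrix inner_scaleR_left)
    then have "(M *v x) \<bullet> (M *v x) + \<mu> * (x \<bullet> x) = 0" using that by simp
    moreover have "0 \<le> (M *v x) \<bullet> (M *v x)" "0 \<le> \<mu> * (x \<bullet> x)" using assms(1) by simp_all
    ultimately have "\<mu> * (x \<bullet> x) = 0" by linarith
    then show "x = 0" using assms(1) by simp
  qed
  then have "S *v u = transpose M *v y + \<mu> *\<^sub>R w"
    unfolding u S_def[symmetric] by (rule matrix_inv_solves)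
  then show ?thesis
    by (simp add: S matrix_vector_mult_diff_distrib algebra_simps del: transpose_matrix_vector)
qed

section \<open>Common kernel of the periodic differences\<close>

text \<open>Every residue is reached from zero by unit steps, as many as its nonnegative
  representative; this also covers a ring with a single element.\<close>

lemma mod_ring_shift_invariant:
  fixes f :: "'a::finite mod_ring \<Rightarrow> 'b"
  assumes "\<And>i. f (i + of_int_mod_ring 1) = f i"
  shows "f i = f 0"
proof -
  have "f (of_int_mod_ring (int n)) = f 0" for n
  proof (induction n)
    case (Suc n)
    have "of_int_mod_ring (int (Suc n)) = (of_int_mod_ring (int n) + of_int_mod_ring 1 :: 'a mod_ring)"
      by transfer (simp add: mod_simps add.commute)
    then show ?case using Suc assms by simp
  qed simp
  moreover have "0 \<le> to_int_mod_ring i"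
    using range_to_int_mod_ring[where 'a='a] by auto
  ultimately show ?thesis
    by (metis nat_0_le of_int_mod_ring_to_int_mod_ring)
qed

lemma difference_row_kernel:
  assumes "\<And>i. difference_row c e i \<bullet> x = 0"
  shows "x $ (i + e) = x $ i"
proof (cases c)
  case Forward
  then show ?thesis using assms[of i] by (simp add: inner_diff_left inner_axis')
next
  case Backward
  \<comment> \<open>The backward difference at \<open>i + e\<close> equals the forward difference at
    \<open>i\<close>.\<close>
  then show ?thesis using assms[of "i + e"] by (simp add: inner_diff_left inner_axis')
qed

lemma difference_matrix_kernel:
  assumes "\<And>i. difference_matrix ch cv i *v x = 0"
  shows "x = x $ 0 *\<^sub>R (\<chi> i. 1)"
proof -
  have "difference_row ch horizontal_step i \<bullet> x = 0" "difference_row cv vertical_step i \<bullet> x = 0" for i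
    using assms[of i]
    by (simp_all add: difference_matrix_def vec_eq_iff forall_2 matrix_vector_mul_component)
  then have "x $ (i + horizontal_step) = x $ i" "x $ (i + vertical_step) = x $ i" for i
    by (blast intro: difference_row_kernel)+
  then have h: "x $ (r, s + of_int_mod_ring 1) = x $ (r, s)"
    and v: "x $ (r + of_int_mod_ring 1, s) = x $ (r, s)" for r s
    by (metis add.right_neutral add_Pair horizontal_step_def vertical_step_def)+
  \<comment> \<open>Move within row \<open>r\<close> to column zero, then along that column to the
    origin.\<close>
  have "x $ (r, s) = x $ 0" for r s
    using mod_ring_shift_invariant[of "\<lambda>s. x $ (r, s)" s, OF h]
      mod_ring_shift_invariant[of "\<lambda>r. x $ (r, 0)" r, OF v] by (simp add: zero_prod_def)
  then show ?thesis by (auto simp: vec_eq_iff)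
qed

section \<open>Existence of a minimizer\<close>

text \<open>Stacking \<open>M ** A\<close> and all \<open>D i\<close> gives an injective map, hence
  one bounded below, whose norm the objective controls. The sublevel set at the value of zero
  therefore lies in a ball, and a minimizer over the ball is global.\<close>

lemma tv_objective_attains_min:
  fixes A :: "real ^ 'n ^ 'n" and M :: "real ^ 'n ^ 'm"
  assumes lam: "lam > 0"
    and ker: "\<And>x. (M ** A) *v x = 0 \<Longrightarrow> (\<And>i. D i *v x = 0) \<Longrightarrow> x = 0"
  shows "\<exists>x. \<forall>x'. tv_objective A M D y lam x \<le> tv_objective A M D y lam x'"
proof -
  let ?f = "tv_objective A M D y lam"
  let ?F = "\<lambda>x. ((M ** A) *v x, \<chi> i. D i *v x)"
  have lin: "linear ?F"
    by (rule linearI) (simp_all add: vec_eq_iff matrix_vector_right_distrib matrix_vector_mult_scaleR)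
  have "x = 0" if "?F x = 0" for x
    by (rule ker) (use that in \<open>simp_all add: zero_prod_def vec_eq_iff\<close>)
  then have "inj ?F" using linear_injective_0[OF lin] by blast
  from linear_inj_bounded_below_pos[OF lin this]
  obtain B where B: "B > 0" "\<And>x. B * norm x \<le> norm (?F x)" by blast
  define c where "c = ?f 0"
  \<comment> \<open>On the sublevel set the data residual is at most \<open>sqrt (2 * c)\<close> and
    the sum of difference norms at most \<open>c / lam\<close>; \<open>B\<close> turns this into a
    bound on \<open>x\<close>.\<close>
  define R where "R = (norm y + sqrt (2 * c) + c / lam) / B"
  have bound: "norm x \<le> R" if "?f x \<le> c" for x
  proof -
    have nonneg: "0 \<le> (norm (y - (M ** A) *v x))\<^sup>2" "0 \<le> lam * (\<Sum>i\<in>UNIV. norm (D i *v x))"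
      using lam by (simp_all add: sum_nonneg)
    have "(norm (y - (M ** A) *v x))\<^sup>2 \<le> 2 * c" "lam * (\<Sum>i\<in>UNIV. norm (D i *v x)) \<le> c"
      using that nonneg unfolding tv_objective_def by linarith+
    then have "norm (y - (M ** A) *v x) \<le> sqrt (2 * c)" "(\<Sum>i\<in>UNIV. norm (D i *v x)) \<le> c / lam"
      using lam by (simp_all add: real_le_rsqrt field_simps)
    moreover have "norm ((M ** A) *v x) \<le> norm y + norm (y - (M ** A) *v x)"
      using norm_triangle_ineq4[of y "y - (M ** A) *v x"] by simp
    moreover have "norm (\<chi> i. D i *v x) \<le> (\<Sum>i\<in>UNIV. norm (D i *v x))"
      unfolding norm_vec_def by (rule order_trans[OF L2_set_le_sum]) auto
    ultimately have "B * norm x \<le> norm y + sqrt (2 * c) + c / lam"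
      using B(2)[of x] norm_Pair_le[of "(M ** A) *v x" "\<chi> i. D i *v x"] by linarith
    then show ?thesis using B(1) by (simp add: R_def field_simps)
  qed
  have "continuous_on UNIV ?f"
    unfolding tv_objective_def by (intro continuous_intros linear_continuous_on) 
  then have "continuous_on (cball 0 R) ?f" by (rule continuous_on_subset) simp
  moreover have "0 \<in> cball 0 R" using bound[of 0] by (simp add: c_def)
  ultimately obtain x where x: "\<forall>x'\<in>cball 0 R. ?f x \<le> ?f x'"
    using continuous_attains_inf[OF compact_cball, of 0 R ?f] by blast
  have "?f x \<le> ?f x'" for x'
  proof (cases "?f x' \<le> c")
    case True
    then show ?thesis using bound x by simp
  next
    case False
    moreover have "?f x \<le> c" using x \<open>0 \<in> cball 0 R\<close> by (simp add: c_def)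
    ultimately show ?thesis by simp
  qed
  then show ?thesis by blast
qed

text \<open>
  \<open>TV_MD\<close> is ADMM with unit penalty once the blocks are rescaled by \<open>sqrt \<mu>\<^sub>1\<close> and \<open>sqrt \<mu>\<^sub>2\<close>.
\<close>

theorem TV_MD_converges:
  fixes A :: "real ^ 'n ^ 'n" and M :: "real ^ 'n ^ 'm"
  assumes lam: "lam > 0" and \<mu>: "\<mu>\<^sub>1 > 0" "\<mu>\<^sub>2 > 0"
    and ker: "\<And>x. (M ** A) *v x = 0 \<Longrightarrow> (\<And>i. D i *v x = 0) \<Longrightarrow> x = 0"
    and TV: "TV_MD A M D y lam \<mu>\<^sub>1 \<mu>\<^sub>2 z u1 d1 u d"
  shows "\<exists>x. (\<forall>x'. tv_objective A M D y lam x \<le> tv_objective A M D y lam x') \<and> z \<longlonglongrightarrow> x"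
proof -
  \<comment> \<open>The square roots make the standard inner product carry the weights
    \<open>\<mu>\<^sub>1\<close> and \<open>\<mu>\<^sub>2\<close>; \<open>g\<close> undoes the
    scaling, so \<open>g (G x)\<close> is the original objective.\<close>
  define pack :: "real ^ 'n \<Rightarrow> ('n \<Rightarrow> real ^ 2) \<Rightarrow> (real ^ 'n) \<times> (real ^ 2 ^ 'n)"
    where "pack v w = (sqrt \<mu>\<^sub>1 *\<^sub>R v, \<chi> i. sqrt \<mu>\<^sub>2 *\<^sub>R w i)" for v w
  define g :: "(real ^ 'n) \<times> (real ^ 2 ^ 'n) \<Rightarrow> real"
    where "g p = 1/2 * (norm (y - M *v (fst p /\<^sub>R sqrt \<mu>\<^sub>1)))\<^sup>2
      + lam * (\<Sum>i\<in>UNIV. norm (snd p $ i /\<^sub>R sqrt \<mu>\<^sub>2))" for p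
  define G where "G x = pack (A *v x) (\<lambda>i. D i *v x)" for x
  have pack_arith: "pack v w + pack v' w' = pack (v + v') (\<lambda>i. w i + w' i)"
    "pack v w - pack v' w' = pack (v - v') (\<lambda>i. w i - w' i)"
    "- pack v w = pack (- v) (\<lambda>i. - w i)" for v v' w w'
    by (simp_all add: pack_def vec_eq_iff scaleR_add_right scaleR_diff_right)
  have pack_inner: "pack v w \<bullet> pack v' w' = \<mu>\<^sub>1 * (v \<bullet> v') + \<mu>\<^sub>2 * (\<Sum>i\<in>UNIV. w i \<bullet> w' i)"
    for v v' w w'
  proof -
    have sqrt: "sqrt \<mu> * (sqrt \<mu> * x) = \<mu> * x" if "\<mu> > 0" for \<mu> x :: real
      using that by (simp flip: mult.assoc)
    show ?thesis
      using \<mu> by (simp add: pack_def inner_vec_def[where 'a="real^2"] sum_distrib_left sqrt)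
  qed
  have g_pack: "g (pack v w) = 1/2 * (norm (y - M *v v))\<^sup>2 + lam * (\<Sum>i\<in>UNIV. norm (w i))" for v w
    using \<mu> by (simp add: g_def pack_def)
  have pack_surj: "\<exists>v w. p = pack v w" for p
  proof (intro exI)
    show "p = pack (fst p /\<^sub>R sqrt \<mu>\<^sub>1) (\<lambda>i. snd p $ i /\<^sub>R sqrt \<mu>\<^sub>2)"
      using \<mu> by (simp add: pack_def prod_eq_iff vec_eq_iff)
  qed
  have f_eq: "tv_objective A M D y lam x = g (G x)" for x
    by (simp add: tv_objective_def G_def g_pack matrix_vector_mul_assoc)
  have ker': "x = 0" if "A *v x = 0" "\<And>i. D i *v x = 0" for x
    by (rule ker) (simp_all add: that flip: matrix_vector_mul_assoc)
  have lin: "linear G"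
    by (rule linearI) (simp_all add: G_def pack_def vec_eq_iff matrix_vector_right_distrib
        matrix_vector_mult_scaleR scaleR_add_right)
  have "x = 0" if "G x = 0" for x
    by (rule ker') (use that \<mu> in \<open>simp_all add: G_def pack_def zero_prod_def vec_eq_iff\<close>)
  then have inj: "inj G" using linear_injective_0[OF lin] by blast
  have g_convex: "convex_on UNIV g"
  proof -
    have "linear (\<lambda>p :: (real ^ 'n) \<times> (real ^ 2 ^ 'n). - (M *v (fst p /\<^sub>R sqrt \<mu>\<^sub>1)))"
      by (rule linearI) (simp_all add: matrix_vector_right_distrib matrix_vector_mult_scaleR
          scaleR_add_right)
    from convex_on_compose_affine[OF convex_on_norm_power2 this, of y]
    have 1: "convex_on UNIV (\<lambda>p :: (real ^ 'n) \<times> (real ^ 2 ^ 'n).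
        (norm (y - M *v (fst p /\<^sub>R sqrt \<mu>\<^sub>1)))\<^sup>2)" by simp
    have 2: "convex_on UNIV (\<lambda>p :: (real ^ 'n) \<times> (real ^ 2 ^ 'n). norm (snd p $ i /\<^sub>R sqrt \<mu>\<^sub>2))" for i
    proof -
      have "linear (\<lambda>p :: (real ^ 'n) \<times> (real ^ 2 ^ 'n). snd p $ i /\<^sub>R sqrt \<mu>\<^sub>2)"
        by (rule linearI) (simp_all add: scaleR_add_right)
      moreover have "convex_on UNIV (norm :: real ^ 2 \<Rightarrow> real)"
        using convex_on_dist[of UNIV "0 :: real ^ 2"] by simp
      ultimately show ?thesis
        using convex_on_compose_affine[of norm _ 0] by fastforce
    qed
    show ?thesis
      unfolding g_def using lam
      by (intro convex_on_add convex_on_cmul convex_on_sum_functions 1 2) simp_all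
  qed
  note step = TV[unfolded TV_MD_def Let_def, rule_format]
  have d1_step: "d1 (Suc k) = d1 k - (A *v z (Suc k) - u1 (Suc k))"
    and d_step: "d (Suc k) i = d k i - (D i *v z (Suc k) - u (Suc k) i)"
    and u_step: "u (Suc k) i = vect_soft (D i *v z (Suc k) - d k i) (lam / \<mu>\<^sub>2)" for k i
    using step[of k] by blast+
  \<comment> \<open>The gradient of the data term at the new \<open>u1\<close> is the negative
    weighted dual variable.\<close>
  have u1_step: "transpose M *v (M *v u1 (Suc k) - y) = - \<mu>\<^sub>1 *\<^sub>R d1 (Suc k)" for k
  proof -
    have "transpose M *v (M *v u1 (Suc k) - y) = \<mu>\<^sub>1 *\<^sub>R (A *v z (Suc k) - d1 k - u1 (Suc k))"
      using step[of k] by (intro ridge_solution[OF \<mu>(1)]) blast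
    then show ?thesis by (simp add: d1_step algebra_simps del: transpose_matrix_vector)
  qed
  have z_orth: "(G (z (Suc k)) - (pack (u1 k) (u k) + pack (d1 k) (d k))) \<bullet> G h = 0" for k h
  proof -
    have "\<mu>\<^sub>1 * ((A *v z (Suc k) - (u1 k + d1 k)) \<bullet> (A *v h))
        + \<mu>\<^sub>2 * (\<Sum>i\<in>UNIV. (D i *v z (Suc k) - (u k i + d k i)) \<bullet> (D i *v h)) = 0"
      by (rule K_matrix_normal_equation[OF ker' \<mu>]) (use step[of k] in \<open>blast+\<close>)
    then show ?thesis by (simp add: G_def pack_arith pack_inner)
  qed
  have d_pack: "pack (d1 (Suc k)) (d (Suc k))
      = pack (d1 k) (d k) - (G (z (Suc k)) - pack (u1 (Suc k)) (u (Suc k)))" for k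
    by (simp add: G_def pack_arith flip: d1_step d_step)
  \<comment> \<open>\<open>g\<close> is separable, so its subgradient inequality is the sum of the
    data inequality and one thresholding inequality per pixel, the latter multiplied by
    \<open>\<mu>\<^sub>2\<close>.\<close>
  have sub: "- pack (d1 (Suc k)) (d (Suc k)) \<in> subdifferential g (pack (u1 (Suc k)) (u (Suc k)))" for k
    unfolding subdifferential_def
  proof safe
    fix p
    obtain v w where p: "p = pack v w" using pack_surj by blast
    have 1: "1/2 * (norm (y - M *v u1 (Suc k)))\<^sup>2 - \<mu>\<^sub>1 * (d1 (Suc k) \<bullet> (v - u1 (Suc k)))
        \<le> 1/2 * (norm (y - M *v v))\<^sup>2"
      using least_squares_subgradient[of y M "u1 (Suc k)" v] unfolding u1_step by simp
    have "lam * norm (u (Suc k) i) - \<mu>\<^sub>2 * (d (Suc k) i \<bullet> (w i - u (Suc k) i)) \<le> lam * norm (w i)" for i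
    proof -
      have "D i *v z (Suc k) - d k i - u (Suc k) i = - d (Suc k) i"
        by (simp add: d_step)
      then have "lam / \<mu>\<^sub>2 * norm (u (Suc k) i) + (- d (Suc k) i) \<bullet> (w i - u (Suc k) i)
          \<le> lam / \<mu>\<^sub>2 * norm (w i)"
        using vect_soft_subgradient[of "lam / \<mu>\<^sub>2" "D i *v z (Suc k) - d k i" "w i"] lam \<mu>
        by (simp flip: u_step)
      from mult_left_mono[OF this, of \<mu>\<^sub>2] show ?thesis
        using \<mu> by (simp add: distrib_left right_diff_distrib)
    qed
    then have 2: "lam * (\<Sum>i\<in>UNIV. norm (u (Suc k) i))
        - \<mu>\<^sub>2 * (\<Sum>i\<in>UNIV. d (Suc k) i \<bullet> (w i - u (Suc k) i)) \<le> lam * (\<Sum>i\<in>UNIV. norm (w i))"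
      unfolding sum_distrib_left sum_subtractf[symmetric] by (intro sum_mono)
    show "g (pack (u1 (Suc k)) (u (Suc k))) + - pack (d1 (Suc k)) (d (Suc k)) \<bullet>
        (p - pack (u1 (Suc k)) (u (Suc k))) \<le> g p"
      unfolding p g_pack pack_arith pack_inner using 1 2 by (simp add: sum_negf)
  qed
  have "\<exists>x. \<forall>x'. g (G x) \<le> g (G x')"
    unfolding f_eq[symmetric] by (rule tv_objective_attains_min[OF lam]) (fact ker)
  then show ?thesis
    unfolding f_eq
    by (rule admm_converges[where u = "\<lambda>k. pack (u1 k) (u k)" and d = "\<lambda>k. pack (d1 k) (d k)",
          OF lin inj g_convex _ z_orth sub d_pack])
qed

theorem proposition7:
  fixes A :: "real ^ ('a::finite, 'b::finite) pixel ^ ('a, 'b) pixel"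
    and M :: "real ^ ('a, 'b) pixel ^ 'm::finite"
    and y :: "real ^ 'm"
    and lam \<mu>\<^sub>1 \<mu>\<^sub>2 :: real
    and ch cv :: difference_convention
    and D :: "('a, 'b) pixel \<Rightarrow> real ^ ('a, 'b) pixel ^ 2"
    and z u1 d1 :: "nat \<Rightarrow> real ^ ('a, 'b) pixel"
    and u d :: "nat \<Rightarrow> ('a, 'b) pixel \<Rightarrow> real ^ 2"
  assumes "CARD('m) < CARD('a) * CARD('b)"
    and "lam > 0"
    and "periodic_convolution A"
    and "masking_matrix M"
    and "D = difference_matrix ch cv"
    and "(\<chi> i. 1) \<notin> {x. (M ** A) *v x = 0}"
    and "\<mu>\<^sub>1 > 0" and "\<mu>\<^sub>2 > 0"
    and "TV_MD A M D y lam \<mu>\<^sub>1 \<mu>\<^sub>2 z u1 d1 u d"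
  shows "\<exists>x. (\<forall>x'. tv_objective A M D y lam x \<le> tv_objective A M D y lam x') \<and> z \<longlonglongrightarrow> x"
proof (rule TV_MD_converges[OF assms(2,7,8) _ assms(9)])
  fix x
  assume MA: "(M ** A) *v x = 0" and D: "\<And>i. D i *v x = 0"
  define c where "c = x $ 0"
  have x: "x = c *\<^sub>R (\<chi> i. 1)"
    unfolding c_def using D unfolding assms(5) by (rule difference_matrix_kernel)
  \<comment> \<open>A constant image in the kernel of \<open>M ** A\<close> has
    \<open>c = 0\<close>, since the image of the all-ones vector is nonzero.\<close>
  have "c *\<^sub>R ((M ** A) *v (\<chi> i. 1)) = 0"
    using MA unfolding x matrix_vector_mult_scaleR .
  moreover have "(M ** A) *v (\<chi> i. 1) \<noteq> 0"
    using assms(6) by blast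
  ultimately show "x = 0"
    unfolding x by simp
qed

end
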